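(* For every integer $n\ge 2$ and every integer $m\ge 1$, $$s_{n,m}=-\sum_{i=2}^{n}c_{i,-(m+1)},$$ where $s_{n,m}=\sum_{k=1}^{n(n+1)/2}(a_{n,k})^m$ is the $m$-th power sum of the roots $a_{n,k}\in\mathbb{C}$ (counted with multiplicity) of the polynomial $Q_n^{[2]}(z)$, and $c_{i,-(m+1)}$ is the coefficient of $z^{-(m+1)}$ in the formal power expansion at $z=\infty$, at $\alpha=i$, of solutions of the fourth-order equation $$w_{zzzz}-10w^2w_{zz}-10ww_z^2+6w^5-zw-\alpha=0.$$
   Context: The polynomials $Q_n^{[2]}(z)$, $n\ge0$, are the special polynomials associated with rational solutions of the equation $w_{zzzz}-10w^2w_{zz}-10ww_z^2+6w^5-zw-\alpha=0$: $Q_0^{[2]}(z)=1$, each $Q_n^{[2]}$ is a monic polynomial of degree $n(n+1)/2$, and for every $n\ge1$ the function $w(z;n)=\frac{d}{dz}\ln\frac{Q^{[2]}_{n-1}(z)}{Q^{[2]}_n(z)}$ is a rational solution of this equation with $\alpha=n$. (The existence of these polynomials is taken as given.) Expansion at infinity: for each $\alpha$ the equation has a unique formal solution of the form $w(z;\alpha)=\frac{c_{\alpha,-1}}{z}+\sum_{l=1}^{\infty}c_{\alpha,-5l-1}z^{-5l-1}$ (with $c_{\alpha,-1}=-\alpha$). It is also written $w(z;\alpha)=\sum_{m=0}^{\infty}c_{\alpha,-(m+1)}z^{-(m+1)}$, where $c_{\alpha,-(m+1)}=0$ unless $m$ is divisible by $5$. *)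

theory Defs
  imports
    "HOL-Complex_Analysis.Complex_Analysis"
begin

section \<open>The fourth-order equation and its special polynomials\<close>

definition fourth_order_solution_on ::
    "complex \<Rightarrow> complex set \<Rightarrow> (complex \<Rightarrow> complex) \<Rightarrow> bool" where
  "fourth_order_solution_on \<alpha> S w \<longleftrightarrow>
     w holomorphic_on S \<and>
     (\<forall>z\<in>S. (deriv ^^ 4) w z - 10 * (w z)^2 * (deriv ^^ 2) w z - 10 * w z * (deriv w z)^2
             + 6 * (w z)^5 - z * w z - \<alpha> = 0)"

text \<open>
  \<open>d/dz ln f\<close> is read as \<open>f' / f\<close>, since \<^const>\<open>Ln\<close> would introduce a spurious branch cut.
\<close>

definition log_deriv :: "(complex \<Rightarrow> complex) \<Rightarrow> complex \<Rightarrow> complex" where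
  "log_deriv f z = deriv f z / f z"

text \<open>
  The equation is imposed off the zeros of \<open>Q (n - 1)\<close> and \<open>Q n\<close>, where evaluating the rational
  function involves no division by zero; these are all but finitely many points.
\<close>

definition special_polynomials :: "(nat \<Rightarrow> complex poly) \<Rightarrow> bool" where
  "special_polynomials Q \<longleftrightarrow>
     Q 0 = 1 \<and>
     (\<forall>n. lead_coeff (Q n) = 1 \<and> degree (Q n) = n * (n + 1) div 2) \<and>
     (\<forall>n\<ge>1. fourth_order_solution_on (of_nat n)
        {z. poly (Q (n - 1)) z \<noteq> 0 \<and> poly (Q n) z \<noteq> 0}
        (log_deriv (\<lambda>z. poly (Q (n - 1)) z / poly (Q n) z)))"

definition root_power_sum :: "complex poly \<Rightarrow> nat \<Rightarrow> complex" where
  "root_power_sum p m = (\<Sum>a\<in>#proots p. a ^ m)"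


section \<open>The formal solution at infinity\<close>

text \<open>
  A formal series in \<open>1/z\<close> is represented by a formal Laurent series in the local parameter
  \<open>x = 1/z\<close>: the coefficient of \<open>z\<^sup>-\<^sup>k\<close> is \<open>fls_nth W k\<close>, the variable \<open>z\<close> is
  \<^const>\<open>fls_X_inv\<close>, and \<open>d/dz = - x\<^sup>2 d/dx\<close>.
\<close>

definition deriv_at_infinity :: "complex fls \<Rightarrow> complex fls" where
  "deriv_at_infinity W = - (fls_X ^ 2 * fls_deriv W)"

definition formal_solution :: "complex \<Rightarrow> complex fls \<Rightarrow> bool" where
  "formal_solution \<alpha> W \<longleftrightarrow>
     (\<forall>k. fls_nth W k \<noteq> 0 \<longrightarrow> (\<exists>l::nat. k = 5 * int l + 1)) \<and>
     (deriv_at_infinity ^^ 4) W - 10 * W^2 * (deriv_at_infinity ^^ 2) W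
       - 10 * W * (deriv_at_infinity W)^2 + 6 * W^5 - fls_X_inv * W - fls_const \<alpha> = 0"

definition expansion_at_infinity :: "complex \<Rightarrow> complex fls" where
  "expansion_at_infinity \<alpha> = (THE W. formal_solution \<alpha> W)"

text \<open>The coefficient of \<open>z\<^sup>j\<close> (with \<open>j\<close> an integer) in the formal solution.\<close>

definition expansion_coeff :: "complex \<Rightarrow> int \<Rightarrow> complex" where
  "expansion_coeff \<alpha> j = fls_nth (expansion_at_infinity \<alpha>) (- j)"


subsection \<open>Existence and uniqueness of the formal solution\<close>

text \<open>
  Over power series in \<open>x\<close>, the equation is the fixed point equation of a contraction \<open>Phi\<close>
  for the \<open>x\<close>-adic metric.
\<close>

definition D_fps :: "complex fps \<Rightarrow> complex fps" where
  "D_fps F = - (fps_X ^ 2 * fps_deriv F)"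

definition Phi :: "complex \<Rightarrow> complex fps \<Rightarrow> complex fps" where
  "Phi \<alpha> F = fps_X * (D_fps (D_fps (D_fps (D_fps F))) - 10 * F^2 * D_fps (D_fps F)
     - 10 * F * (D_fps F)^2 + 6 * F^5 - fps_const \<alpha>)"

definition agree :: "nat \<Rightarrow> complex fps \<Rightarrow> complex fps \<Rightarrow> bool" where
  "agree N F G \<longleftrightarrow> (\<forall>k<N. fps_nth F k = fps_nth G k)"

lemma agree_mult: "agree N F G \<Longrightarrow> agree N F' G' \<Longrightarrow> agree N (F * F') (G * G')"
  unfolding agree_def fps_mult_nth by (auto intro!: sum.cong)

lemma agree_power: "agree N F G \<Longrightarrow> agree N (F ^ k) (G ^ k)"
  by (induction k) (auto simp: agree_mult, simp add: agree_def)

lemma D_fps_nth: "fps_nth (D_fps F) k = - (of_nat (k - 1) * fps_nth F (k - 1))"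
  unfolding D_fps_def
  by (cases k) (auto simp: fps_X_power_mult_nth Suc_diff_Suc)

lemma agree_D_fps: "agree N F G \<Longrightarrow> agree N (D_fps F) (D_fps G)"
  unfolding agree_def D_fps_nth by auto

lemma agree_refl: "agree N F F"
  by (simp add: agree_def)

lemma agree_add: "agree N F G \<Longrightarrow> agree N F' G' \<Longrightarrow> agree N (F + F') (G + G')"
  by (simp add: agree_def)

lemma agree_diff: "agree N F G \<Longrightarrow> agree N F' G' \<Longrightarrow> agree N (F - F') (G - G')"
  by (simp add: agree_def)

lemma agree_X: "agree N F G \<Longrightarrow> agree (Suc N) (fps_X * F) (fps_X * G)"
  by (auto simp: agree_def)

lemma agree_Phi: "agree N F G \<Longrightarrow> agree (Suc N) (Phi \<alpha> F) (Phi \<alpha> G)"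
  unfolding Phi_def
  by (intro agree_X agree_diff agree_add agree_mult agree_power agree_D_fps agree_refl)

definition supp5 :: "nat \<Rightarrow> complex fps \<Rightarrow> bool" where
  "supp5 r F \<longleftrightarrow> (\<forall>k. fps_nth F k \<noteq> 0 \<longrightarrow> k mod 5 = r mod 5)"

lemma supp5_mult: "supp5 r F \<Longrightarrow> supp5 s G \<Longrightarrow> supp5 (r + s) (F * G)"
  unfolding supp5_def
proof (intro allI impI)
  fix k assume F: "\<forall>k. fps_nth F k \<noteq> 0 \<longrightarrow> k mod 5 = r mod 5"
    and G: "\<forall>k. fps_nth G k \<noteq> 0 \<longrightarrow> k mod 5 = s mod 5" and "fps_nth (F * G) k \<noteq> 0"
  then have "(\<Sum>i=0..k. fps_nth F i * fps_nth G (k - i)) \<noteq> 0"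
    by (simp add: fps_mult_nth)
  then obtain i where "i \<in> {0..k}" "fps_nth F i * fps_nth G (k - i) \<noteq> 0"
    by (meson sum.neutral)
  then have "i \<le> k" "i mod 5 = r mod 5" "(k - i) mod 5 = s mod 5"
    using F G by auto
  then have "(i + (k - i)) mod 5 = (r + s) mod 5"
    by (metis mod_add_cong)
  with \<open>i \<le> k\<close> show "k mod 5 = (r + s) mod 5" by simp
qed

lemma supp5_cong: "supp5 r F \<Longrightarrow> r mod 5 = s mod 5 \<Longrightarrow> supp5 s F"
  by (simp add: supp5_def)

lemma supp5_D: "supp5 r F \<Longrightarrow> supp5 (Suc r) (D_fps F)"
  unfolding supp5_def
proof (intro allI impI)
  fix k assume F: "\<forall>k. fps_nth F k \<noteq> 0 \<longrightarrow> k mod 5 = r mod 5" and "fps_nth (D_fps F) k \<noteq> 0"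
  then obtain l where "k = Suc l" "fps_nth F l \<noteq> 0"
    by (cases k) (auto simp: D_fps_nth)
  with F show "k mod 5 = Suc r mod 5" by (simp add: mod_Suc)
qed

lemma supp5_add: "supp5 r F \<Longrightarrow> supp5 r G \<Longrightarrow> supp5 r (F + G)"
  unfolding supp5_def fps_add_nth by (metis add.right_neutral)

lemma supp5_diff: "supp5 r F \<Longrightarrow> supp5 r G \<Longrightarrow> supp5 r (F - G)"
  unfolding supp5_def fps_sub_nth by (metis diff_zero)

lemma supp5_const: "supp5 0 (fps_const c)"
  by (simp add: supp5_def)

lemma supp5_numeral: "supp5 0 (numeral c)"
  unfolding numeral_fps_const by (rule supp5_const)

lemma supp5_power: "supp5 r F \<Longrightarrow> supp5 (k * r) (F ^ k)"
proof (induction k)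
  case 0
  then show ?case using supp5_const[of 1] by simp
next
  case (Suc k)
  then show ?case using supp5_mult[of r F "k * r"] by simp
qed

lemma supp5_Phi:
  assumes F: "supp5 1 F"
  shows "supp5 1 (Phi \<alpha> F)"
proof -
  have D1: "supp5 2 (D_fps F)" using supp5_D[OF F] by (simp add: numeral_eq_Suc)
  have D2: "supp5 3 (D_fps (D_fps F))" using supp5_D[OF D1] by (simp add: numeral_eq_Suc)
  have D3: "supp5 4 (D_fps (D_fps (D_fps F)))" using supp5_D[OF D2] by (simp add: numeral_eq_Suc)
  have D4: "supp5 5 (D_fps (D_fps (D_fps (D_fps F))))"
    using supp5_D[OF D3] by (simp add: numeral_eq_Suc)
  have 1: "supp5 0 (D_fps (D_fps (D_fps (D_fps F))))"
    by (rule supp5_cong[OF D4]) simp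
  have 2: "supp5 0 (10 * F^2 * D_fps (D_fps F))"
    by (rule supp5_cong[OF supp5_mult[OF supp5_mult[OF supp5_numeral supp5_power[OF F]] D2]]) simp
  have 3: "supp5 0 (10 * F * (D_fps F)^2)"
    by (rule supp5_cong[OF supp5_mult[OF supp5_mult[OF supp5_numeral F] supp5_power[OF D1]]]) simp
  have 4: "supp5 0 (6 * F^5)"
    by (rule supp5_cong[OF supp5_mult[OF supp5_numeral supp5_power[OF F]]]) simp
  have X: "supp5 1 (fps_X :: complex fps)"
    by (auto simp: supp5_def fps_X_def)
  show ?thesis
    unfolding Phi_def
    by (rule supp5_cong[OF supp5_mult[OF X
          supp5_diff[OF supp5_add[OF supp5_diff[OF supp5_diff[OF 1 2] 3] 4] supp5_const]]]) simp
qed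

lemma Phi_fixed_point: "\<exists>F. supp5 1 F \<and> Phi \<alpha> F = F"
proof -
  define A where "A n = (Phi \<alpha> ^^ n) 0" for n
  have A_Suc: "A (Suc n) = Phi \<alpha> (A n)" for n by (simp add: A_def)
  have step: "agree n (A n) (A (Suc n))" for n
    by (induction n) (auto simp: A_Suc agree_Phi, simp add: agree_def)
  have agr: "agree n (A n) (A (n + d))" for n d
  proof (induction d)
    case (Suc d)
    then show ?case using step[of "n + d"] by (auto simp: agree_def)
  qed (simp add: agree_refl)
  have supp: "supp5 1 (A n)" for n
    by (induction n) (auto simp: A_Suc supp5_Phi simp del: One_nat_def, simp add: A_def supp5_def)
  define F where "F = Abs_fps (\<lambda>k. fps_nth (A (Suc k)) k)"
  have FA: "agree n F (A n)" for n
    unfolding agree_def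
  proof (intro allI impI)
    fix k assume "k < n"
    then show "fps_nth F k = fps_nth (A n) k"
      using agr[of "Suc k" "n - Suc k"] by (simp add: F_def agree_def)
  qed
  have "supp5 1 F"
    using supp by (auto simp: F_def supp5_def)
  moreover have "Phi \<alpha> F = F"
  proof (rule fps_ext)
    fix k
    show "fps_nth (Phi \<alpha> F) k = fps_nth F k"
      using agree_Phi[OF FA[of k], of \<alpha>] FA[of "Suc k"] by (simp add: agree_def A_Suc)
  qed
  ultimately show ?thesis by blast
qed

lemma Phi_fixed_point_unique:
  assumes "Phi \<alpha> F = F" "Phi \<alpha> G = G"
  shows "F = G"
proof (rule fps_ext)
  have "agree n F G" for n
  proof (induction n)
    case (Suc n)
    then show ?case using agree_Phi[OF Suc, of \<alpha>] assms by simp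
  qed (simp add: agree_def)
  then show "fps_nth F k = fps_nth G k" for k by (auto simp: agree_def)
qed

lemma deriv_at_infinity_fps: "deriv_at_infinity (fps_to_fls F) = fps_to_fls (D_fps F)"
  by (simp add: deriv_at_infinity_def D_fps_def fls_times_fps_to_fls fps_to_fls_power
      fls_deriv_fps_to_fls)

lemma equation_iff_Phi:
  fixes F :: "complex fps"
  defines "W \<equiv> fps_to_fls F"
  shows "(deriv_at_infinity ^^ 4) W - 10 * W^2 * (deriv_at_infinity ^^ 2) W
       - 10 * W * (deriv_at_infinity W)^2 + 6 * W^5 - fls_X_inv * W - fls_const \<alpha> = 0
     \<longleftrightarrow> Phi \<alpha> F = F"  (is "?E = 0 \<longleftrightarrow> _")
proof -
  define B where "B = D_fps (D_fps (D_fps (D_fps F))) - 10 * F^2 * D_fps (D_fps F)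
     - 10 * F * (D_fps F)^2 + 6 * F^5 - fps_const \<alpha>"
  have it: "(deriv_at_infinity ^^ 4) V =
      deriv_at_infinity (deriv_at_infinity (deriv_at_infinity (deriv_at_infinity V)))"
    "(deriv_at_infinity ^^ 2) V = deriv_at_infinity (deriv_at_infinity V)" for V
    by (simp_all add: eval_nat_numeral)
  have E: "?E = fps_to_fls B - fls_X_inv * W"
    unfolding W_def B_def it
    by (simp only: deriv_at_infinity_fps fls_times_fps_to_fls fps_to_fls_power fps_to_fls_plus
        fps_to_fls_minus fps_to_fls_numeral fps_const_to_fls) (simp only: diff_diff_eq add.commute)
  have X: "fls_X * fls_X_inv = (1 :: complex fls)"
    by (simp add: fls_X_times_conv_shift)
  have "?E = 0 \<longleftrightarrow> fls_X * ?E = 0" by simp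
  also have "fls_X * ?E = fps_to_fls (fps_X * B) - W"
    unfolding E by (simp add: algebra_simps fls_times_fps_to_fls mult.assoc[symmetric] X)
  also have "\<dots> = 0 \<longleftrightarrow> Phi \<alpha> F = F"
    by (simp add: W_def Phi_def B_def)
  finally show ?thesis .
qed

lemma formal_solution_fps:
  "formal_solution \<alpha> (fps_to_fls F) \<longleftrightarrow> supp5 1 F \<and> Phi \<alpha> F = F"
proof -
  have "(\<forall>k. fls_nth (fps_to_fls F) k \<noteq> 0 \<longrightarrow> (\<exists>l::nat. k = 5 * int l + 1)) \<longleftrightarrow> supp5 1 F"
  proof
    assume L: "\<forall>k. fls_nth (fps_to_fls F) k \<noteq> 0 \<longrightarrow> (\<exists>l::nat. k = 5 * int l + 1)"
    show "supp5 1 F"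
      unfolding supp5_def
    proof (intro allI impI)
      fix k assume "fps_nth F k \<noteq> 0"
      then obtain l where "int k = 5 * int l + 1" using L[rule_format, of "int k"] by auto
      then show "k mod 5 = 1 mod 5" by presburger
    qed
  next
    assume R: "supp5 1 F"
    show "\<forall>k. fls_nth (fps_to_fls F) k \<noteq> 0 \<longrightarrow> (\<exists>l::nat. k = 5 * int l + 1)"
    proof (intro allI impI)
      fix k :: int assume k: "fls_nth (fps_to_fls F) k \<noteq> 0"
      then have "k \<ge> 0" and "fps_nth F (nat k) \<noteq> 0" by (auto split: if_splits)
      with R have "nat k mod 5 = 1" by (auto simp: supp5_def)
      then have "nat k = 5 * (nat k div 5) + 1" by (metis mult_div_mod_eq)
      with \<open>k \<ge> 0\<close> have "k = 5 * int (nat k div 5) + 1" by linarith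
      then show "\<exists>l::nat. k = 5 * int l + 1" by blast
    qed
  qed
  then show ?thesis
    by (simp only: formal_solution_def equation_iff_Phi)
qed

lemma formal_solution_imp_fps:
  assumes "formal_solution \<alpha> W"
  obtains F where "W = fps_to_fls F"
proof
  show "W = fps_to_fls (fls_regpart W)"
  proof (rule fls_eqI)
    fix k
    show "fls_nth W k = fls_nth (fps_to_fls (fls_regpart W)) k"
      using assms by (cases "k \<ge> 0") (auto simp: formal_solution_def)
  qed
qed

lemma formal_solution_ex1: "\<exists>!W. formal_solution \<alpha> W"
proof -
  obtain F where "supp5 1 F" "Phi \<alpha> F = F"
    using Phi_fixed_point by blast
  then have "formal_solution \<alpha> (fps_to_fls F)"
    by (simp only: formal_solution_fps simp_thms)
  moreover have "V = W" if "formal_solution \<alpha> V" "formal_solution \<alpha> W" for V W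
    using that by (metis formal_solution_fps formal_solution_imp_fps Phi_fixed_point_unique)
  ultimately show ?thesis by blast
qed

lemma formal_solution_expansion: "formal_solution \<alpha> (expansion_at_infinity \<alpha>)"
  unfolding expansion_at_infinity_def by (rule theI'[OF formal_solution_ex1])

end

theory Submission
  imports Defs "HOL-Computational_Algebra.Fundamental_Theorem_Algebra"
begin

text \<open>
  Since \<open>p' / p = \<Sum> 1 / (z - a)\<close> over the roots \<open>a\<close> of \<open>p\<close>, the coefficient of \<open>z\<^sup>-\<^sup>m\<^sup>-\<^sup>1\<close> in the expansion
  at infinity of \<open>w(z; n)\<close> is \<open>s\<^sub>n\<^sub>-\<^sub>1\<^sub>,\<^sub>m - s\<^sub>n\<^sub>,\<^sub>m\<close>. That expansion is a formal solution of the
  equation at \<open>\<alpha> = n\<close>, so by uniqueness it is the formal solution, and the sum over \<open>n\<close> telescopes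
  down to \<open>s\<^sub>1\<^sub>,\<^sub>m\<close>. The coefficient of \<open>z\<^sup>-\<^sup>2\<close> at \<open>\<alpha> = 1\<close> is minus the only root of \<open>Q\<^sub>1\<close>; it
  vanishes because only exponents \<open>-5l - 1\<close> occur, so \<open>s\<^sub>1\<^sub>,\<^sub>m = 0\<close> for \<open>m \<ge> 1\<close>.
\<close>

section \<open>Convergent expansions at infinity\<close>

text \<open>The witness \<open>g\<close> is the function in the local parameter x = 1/z. It links
  pointwise facts about \<open>u\<close> with identities of power series; agreement is asked only
  near infinity, so poles at the roots of the polynomials do no harm.\<close>

definition expands_at_infinity :: "(complex \<Rightarrow> complex) \<Rightarrow> complex fps \<Rightarrow> bool" where
  "expands_at_infinity u F \<longleftrightarrow>
     (\<exists>g. g has_fps_expansion F \<and> (\<forall>\<^sub>F z in at_infinity. u z = g (inverse z)))"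

lemma expands_at_infinity_cong:
  assumes "\<forall>\<^sub>F z in at_infinity. u z = v z" "expands_at_infinity v F"
  shows "expands_at_infinity u F"
proof -
  obtain g where "g has_fps_expansion F" "\<forall>\<^sub>F z in at_infinity. v z = g (inverse z)"
    using assms(2) unfolding expands_at_infinity_def by blast
  with assms(1) show ?thesis
    unfolding expands_at_infinity_def
    by (intro exI[of _ g]) (auto elim: eventually_elim2)
qed

lemma expands_at_infinity_const: "expands_at_infinity (\<lambda>_. c) (fps_const c)"
  unfolding expands_at_infinity_def by (intro exI[of _ "\<lambda>_. c"]) auto

lemma expands_at_infinity_numeral: "expands_at_infinity (\<lambda>_. numeral k) (numeral k)"
  unfolding numeral_fps_const by (rule expands_at_infinity_const)

lemma expands_at_infinity_inverse: "expands_at_infinity inverse fps_X"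
  unfolding expands_at_infinity_def
  by (intro exI[of _ "\<lambda>x. x"]) (auto intro: fps_expansion_intros)

lemma expands_at_infinity_add:
  assumes "expands_at_infinity u F" "expands_at_infinity v G"
  shows "expands_at_infinity (\<lambda>z. u z + v z) (F + G)"
proof -
  obtain f g where "f has_fps_expansion F" "g has_fps_expansion G"
    "\<forall>\<^sub>F z in at_infinity. u z = f (inverse z)" "\<forall>\<^sub>F z in at_infinity. v z = g (inverse z)"
    using assms unfolding expands_at_infinity_def by blast
  then show ?thesis
    unfolding expands_at_infinity_def
    by (intro exI[of _ "\<lambda>x. f x + g x"] conjI has_fps_expansion_add)
       (auto elim: eventually_elim2)
qed

lemma expands_at_infinity_diff:
  assumes "expands_at_infinity u F" "expands_at_infinity v G"
  shows "expands_at_infinity (\<lambda>z. u z - v z) (F - G)"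
proof -
  obtain f g where "f has_fps_expansion F" "g has_fps_expansion G"
    "\<forall>\<^sub>F z in at_infinity. u z = f (inverse z)" "\<forall>\<^sub>F z in at_infinity. v z = g (inverse z)"
    using assms unfolding expands_at_infinity_def by blast
  then show ?thesis
    unfolding expands_at_infinity_def
    by (intro exI[of _ "\<lambda>x. f x - g x"] conjI has_fps_expansion_diff)
       (auto elim: eventually_elim2)
qed

lemma expands_at_infinity_mult:
  assumes "expands_at_infinity u F" "expands_at_infinity v G"
  shows "expands_at_infinity (\<lambda>z. u z * v z) (F * G)"
proof -
  obtain f g where "f has_fps_expansion F" "g has_fps_expansion G"
    "\<forall>\<^sub>F z in at_infinity. u z = f (inverse z)" "\<forall>\<^sub>F z in at_infinity. v z = g (inverse z)"
    using assms unfolding expands_at_infinity_def by blast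
  then show ?thesis
    unfolding expands_at_infinity_def
    by (intro exI[of _ "\<lambda>x. f x * g x"] conjI has_fps_expansion_mult)
       (auto elim: eventually_elim2)
qed

lemma expands_at_infinity_power:
  assumes "expands_at_infinity u F"
  shows "expands_at_infinity (\<lambda>z. u z ^ k) (F ^ k)"
proof (induction k)
  case 0
  show ?case using expands_at_infinity_const[of 1] by simp
next
  case (Suc k)
  show ?case using expands_at_infinity_mult[OF assms Suc] by simp
qed

text \<open>Chain rule: differentiating g(1/z) gives -(1/z)^2 g'(1/z), which is d/dz = -x^2 d/dx,
  the operator behind \<open>D_fps\<close>.\<close>

lemma expands_at_infinity_deriv:
  assumes "expands_at_infinity u F"
  shows "expands_at_infinity (deriv u) (D_fps F)"
proof -
  obtain g where g: "g has_fps_expansion F" "\<forall>\<^sub>F z in at_infinity. u z = g (inverse z)"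
    using assms unfolding expands_at_infinity_def by blast
  have "g analytic_on {0}"
    using g(1) by (rule has_fps_expansion_imp_analytic_0)
  then obtain r where r: "r > 0" "g holomorphic_on ball 0 r"
    unfolding analytic_on_def by auto
  obtain b where b: "\<And>z. norm z \<ge> b \<Longrightarrow> u z = g (inverse z)"
    using g(2) unfolding eventually_at_infinity by blast
  \<comment> \<open>Beyond \<open>b\<close> the function \<open>u\<close> is g(1/z); beyond 1/r the
    point 1/z lies in the disc where \<open>g\<close> is holomorphic. The strict inequality makes
    \<open>S\<close> open, so the identity for \<open>u\<close> holds around each point of
    \<open>S\<close> and can be differentiated there.\<close>
  define S where "S = {z :: complex. max b (1 / r) < norm z}"
  have "open S"
    unfolding S_def by (intro open_Collect_less continuous_intros)
  have "deriv u z = - ((inverse z)\<^sup>2 * deriv g (inverse z))" if "z \<in> S" for z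
  proof -
    have "1 / r < norm z" using that by (simp add: S_def)
    moreover have "0 < 1 / r" using r by simp
    ultimately have z: "z \<noteq> 0" "inverse z \<in> ball 0 r"
      using r(1) by (force, auto simp: norm_divide inverse_eq_divide divide_less_eq mult.commute)
    have "(g has_field_derivative deriv g (inverse z)) (at (inverse z))"
      using r(2) z(2) by (intro holomorphic_derivI[of _ "ball 0 r"]) auto
    then have "((\<lambda>x. g (inverse x)) has_field_derivative
        deriv g (inverse z) * - (inverse z * 1 * inverse z)) (at z)"
      using z(1) by (intro DERIV_chain2[where f = g] DERIV_inverse' DERIV_ident)
    moreover have "\<forall>\<^sub>F x in nhds z. u x = g (inverse x)"
      using \<open>open S\<close> that b by (intro eventually_nhds_in_open[THEN eventually_mono]) (auto simp: S_def)
    ultimately have "(u has_field_derivative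
        deriv g (inverse z) * - (inverse z * 1 * inverse z)) (at z)"
      by (subst DERIV_cong_ev[OF refl _ refl])
    then show ?thesis
      by (simp add: DERIV_imp_deriv power2_eq_square)
  qed
  moreover have "\<forall>\<^sub>F z in at_infinity. z \<in> S"
    unfolding eventually_at_infinity S_def mem_Collect_eq
    by (intro exI[of _ "max b (1 / r) + 1"] allI impI) linarith
  ultimately have "\<forall>\<^sub>F z in at_infinity. deriv u z = - ((inverse z)\<^sup>2 * deriv g (inverse z))"
    by (rule eventually_mono[rotated])
  moreover have "(\<lambda>x. - (x\<^sup>2 * deriv g x)) has_fps_expansion D_fps F"
    unfolding D_fps_def using g(1)
    by (intro has_fps_expansion_minus has_fps_expansion_mult has_fps_expansion_deriv
        has_fps_expansion_fps_X_power)
  ultimately show ?thesis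
    unfolding expands_at_infinity_def by blast
qed

lemma expands_at_infinity_unique:
  assumes "expands_at_infinity u F" "expands_at_infinity u G"
  shows "F = G"
proof -
  obtain f g where fg: "f has_fps_expansion F" "g has_fps_expansion G"
    "\<forall>\<^sub>F z in at_infinity. u z = f (inverse z)" "\<forall>\<^sub>F z in at_infinity. u z = g (inverse z)"
    using assms unfolding expands_at_infinity_def by blast
  from fg(3,4) have "\<forall>\<^sub>F z in at_infinity. f (inverse z) - g (inverse z) = 0"
    by eventually_elim auto
  then have ev: "\<forall>\<^sub>F x in at 0. f x - g x = 0"
    unfolding at_to_infinity eventually_filtermap by simp
  have exp: "(\<lambda>x. f x - g x) has_fps_expansion F - G"
    by (intro has_fps_expansion_diff fg)
  \<comment> \<open>Agreement near infinity controls x = 1/z only for x \<noteq> 0, whereas an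
    expansion concerns a full neighbourhood of 0. Continuity supplies the value at 0.\<close>
  then have "((\<lambda>x. f x - g x) \<longlongrightarrow> f 0 - g 0) (at 0)"
    using has_fps_expansion_imp_continuous[of "\<lambda>x. f x - g x" "F - G" UNIV]
    by (simp add: continuous_within)
  moreover have "((\<lambda>x. f x - g x) \<longlongrightarrow> 0) (at 0)"
    using ev by (rule tendsto_eventually)
  ultimately have "f 0 - g 0 = 0"
    using tendsto_unique[OF trivial_limit_at] by blast
  with ev have "\<forall>\<^sub>F x in nhds 0. f x - g x = 0"
    by (simp add: eventually_nhds_conv_at)
  then have "(\<lambda>x. f x - g x) has_fps_expansion 0"
    by (simp add: has_fps_expansion_0_iff)
  with exp have "F - G = 0" by (rule fps_expansion_unique_complex)
  then show ?thesis by simp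
qed

section \<open>From the differential equation to the fixed point equation\<close>

text \<open>Isolating z w and dividing by z turns the equation into w = (1/z) B, where B collects
  the other terms. The right side expands to \<open>Phi \<alpha> F\<close>, and expansions are
  unique.\<close>

lemma fourth_order_solution_expansion:
  assumes sol: "fourth_order_solution_on \<alpha> S w"
    and S: "\<forall>\<^sub>F z in at_infinity. z \<in> S"
    and w: "expands_at_infinity w F"
  shows "Phi \<alpha> F = F"
proof -
  have D: "expands_at_infinity ((deriv ^^ 4) w) (D_fps (D_fps (D_fps (D_fps F))))"
    "expands_at_infinity ((deriv ^^ 2) w) (D_fps (D_fps F))"
    by (simp_all add: eval_nat_numeral expands_at_infinity_deriv w)
  let ?B = "\<lambda>z. (deriv ^^ 4) w z - 10 * (w z)^2 * (deriv ^^ 2) w z - 10 * w z * (deriv w z)^2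
      + 6 * (w z)^5 - \<alpha>"
  have "expands_at_infinity (\<lambda>z. inverse z * ?B z) (Phi \<alpha> F)"
    unfolding Phi_def
    by (intro expands_at_infinity_mult expands_at_infinity_diff expands_at_infinity_add
        expands_at_infinity_power expands_at_infinity_numeral expands_at_infinity_const
        expands_at_infinity_inverse expands_at_infinity_deriv D w)
  moreover have "\<forall>\<^sub>F z in at_infinity. w z = inverse z * ?B z"
    using S eventually_not_equal_at_infinity[of 0]
  proof eventually_elim
    case (elim z)
    then have "?B z = z * w z"
      using sol by (auto simp: fourth_order_solution_on_def algebra_simps)
    with elim(2) show ?case by (simp add: field_simps)
  qed
  ultimately have "expands_at_infinity w (Phi \<alpha> F)"
    by (rule expands_at_infinity_cong[rotated])
  with w show ?thesis by (rule expands_at_infinity_unique[rotated])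
qed

section \<open>Logarithmic derivatives and power sums of roots\<close>

lemma eventually_poly_nonzero_at_infinity:
  fixes p :: "complex poly"
  assumes "p \<noteq> 0"
  shows "\<forall>\<^sub>F z in at_infinity. poly p z \<noteq> 0"
proof -
  obtain b where "\<And>z. poly p z = 0 \<Longrightarrow> norm z \<le> b"
    using finite_imp_bounded[OF poly_roots_finite[OF assms]] unfolding bounded_iff by auto
  then show ?thesis
    unfolding eventually_at_infinity by (intro exI[of _ "b + 1"]) force
qed

lemma log_deriv_mult:
  assumes "f field_differentiable at z" "g field_differentiable at z" "f z \<noteq> 0" "g z \<noteq> 0"
  shows "log_deriv (\<lambda>z. f z * g z) z = log_deriv f z + log_deriv g z"
  using assms by (simp add: log_deriv_def field_simps)

lemma log_deriv_divide:
  assumes "f field_differentiable at z" "g field_differentiable at z" "f z \<noteq> 0" "g z \<noteq> 0"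
  shows "log_deriv (\<lambda>z. f z / g z) z = log_deriv f z - log_deriv g z"
  using assms by (simp add: log_deriv_def field_simps power2_eq_square)

lemma field_differentiable_poly: "poly p field_differentiable at z"
  for p :: "complex poly"
  unfolding field_differentiable_def by (rule exI, rule poly_DERIV)

lemma log_deriv_linear: "log_deriv (poly [:- a, 1:]) z = inverse (z - a)"
  by (simp only: log_deriv_def DERIV_imp_deriv[OF poly_DERIV]) (simp add: pderiv_pCons divide_inverse)

text \<open>Geometric series: 1/(z - a) = (1/z) / (1 - a/z), so a^m is the coefficient of
  z^(-m-1).\<close>

lemma expands_at_infinity_inverse_diff:
  "expands_at_infinity (\<lambda>z. inverse (z - a)) (fps_X * Abs_fps (\<lambda>m. a ^ m))"
proof -
  have geo: "inverse (1 - fps_const a * fps_X) = Abs_fps (\<lambda>m. a ^ m)"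
    using one_minus_const_fps_X_neg_power'[of 1 a] by simp
  show ?thesis
    unfolding expands_at_infinity_def
  proof (intro exI conjI)
    show "(\<lambda>x. x * inverse (1 - a * x)) has_fps_expansion fps_X * Abs_fps (\<lambda>m. a ^ m)"
      unfolding geo[symmetric]
      by (intro has_fps_expansion_mult has_fps_expansion_fps_X has_fps_expansion_inverse
          has_fps_expansion_diff has_fps_expansion_1 has_fps_expansion_cmult_left) simp
    show "\<forall>\<^sub>F z in at_infinity. inverse (z - a) = inverse z * inverse (1 - a * inverse z)"
      using eventually_not_equal_at_infinity[of 0]
      by eventually_elim (simp add: inverse_mult_distrib[symmetric] algebra_simps)
  qed
qed

text \<open>Induction over the multiset of roots: each linear factor adds its own geometric series,
  so a repeated root is counted with its multiplicity.\<close>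

lemma expands_at_infinity_log_deriv_prod:
  "expands_at_infinity (log_deriv (poly (\<Prod>a\<in>#A. [:- a, 1:])))
     (fps_X * Abs_fps (\<lambda>m. \<Sum>a\<in>#A. a ^ m))"
proof (induction A)
  case empty
  have "log_deriv (\<lambda>_. 1) = (\<lambda>_. 0)"
    by (simp add: log_deriv_def fun_eq_iff)
  then show ?case
    using expands_at_infinity_const[of 0] by (simp add: fps_zero_def[symmetric])
next
  case (add a A)
  let ?q = "\<Prod>a\<in>#A. [:- a, 1:]"
  have "?q \<noteq> 0" by (auto simp: prod_mset_zero_iff)
  \<comment> \<open>Additivity of the logarithmic derivative requires both factors to be nonzero at
    \<open>z\<close>; this holds for all large \<open>z\<close>.\<close>
  have "\<forall>\<^sub>F z in at_infinity.
      log_deriv (poly ([:- a, 1:] * ?q)) z = inverse (z - a) + log_deriv (poly ?q) z"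
    using eventually_poly_nonzero_at_infinity[OF \<open>?q \<noteq> 0\<close>] eventually_not_equal_at_infinity[of a]
  proof eventually_elim
    case (elim z)
    have "poly ([:- a, 1:] * ?q) = (\<lambda>z. poly [:- a, 1:] z * poly ?q z)"
      by (simp only: poly_mult fun_eq_iff simp_thms)
    moreover have "log_deriv (\<lambda>z. poly [:- a, 1:] z * poly ?q z) z =
        log_deriv (poly [:- a, 1:]) z + log_deriv (poly ?q) z"
      using elim by (intro log_deriv_mult field_differentiable_poly) simp_all
    ultimately show ?case
      by (simp only: log_deriv_linear)
  qed
  moreover have "fps_X * Abs_fps (\<lambda>m. \<Sum>a\<in>#add_mset a A. a ^ m) =
      fps_X * Abs_fps (\<lambda>m. a ^ m) + fps_X * Abs_fps (\<lambda>m. \<Sum>a\<in>#A. a ^ m)"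
    by (auto simp: fps_eq_iff)
  ultimately show ?case
    using expands_at_infinity_cong[OF _ expands_at_infinity_add[OF
        expands_at_infinity_inverse_diff add.IH]]
    by (simp only: image_mset_add_mset prod_mset.add_mset)
qed

text \<open>Over the complex numbers a monic polynomial is the product of z - a over its root
  multiset.\<close>

lemma expands_at_infinity_log_deriv_poly:
  assumes "lead_coeff p = 1"
  shows "expands_at_infinity (log_deriv (poly p)) (fps_X * Abs_fps (root_power_sum p))"
  using expands_at_infinity_log_deriv_prod[of "proots p"] complex_poly_decompose_multiset[of p] assms
  by (simp add: root_power_sum_def[abs_def])

section \<open>Coefficients as differences of power sums, and telescoping\<close>

text \<open>The factor \<open>fps_X\<close> in \<open>F\<close> moves the m-th power sums to
  exponent m + 1. Since \<open>F\<close> and the formal solution are both fixed points of the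
  contraction \<open>Phi\<close>, they coincide; that \<open>F\<close> has only exponents 5l + 1 is
  then a consequence.\<close>

lemma special_polynomials_expansion_coeff:
  assumes Q: "special_polynomials Q"
  shows "expansion_coeff (of_nat (Suc n)) (- (int m + 1)) =
    root_power_sum (Q n) m - root_power_sum (Q (Suc n)) m"
proof -
  define F where "F = fps_X * Abs_fps (root_power_sum (Q n))
    - fps_X * Abs_fps (root_power_sum (Q (Suc n)))"
  define w where "w = log_deriv (\<lambda>z. poly (Q n) z / poly (Q (Suc n)) z)"
  have lead: "lead_coeff (Q k) = 1" for k
    using Q unfolding special_polynomials_def by blast
  have nz: "\<forall>\<^sub>F z in at_infinity. poly (Q k) z \<noteq> 0" for k
    using lead[of k] by (intro eventually_poly_nonzero_at_infinity) auto
  have sol: "fourth_order_solution_on (of_nat (Suc n))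
      {z. poly (Q n) z \<noteq> 0 \<and> poly (Q (Suc n)) z \<noteq> 0} w"
  proof -
    have "fourth_order_solution_on (of_nat k) {z. poly (Q (k - 1)) z \<noteq> 0 \<and> poly (Q k) z \<noteq> 0}
        (log_deriv (\<lambda>z. poly (Q (k - 1)) z / poly (Q k) z))" if "k \<ge> 1" for k
      using Q that unfolding special_polynomials_def by blast
    from this[of "Suc n"] show ?thesis by (simp add: w_def)
  qed
  have "\<forall>\<^sub>F z in at_infinity. w z = log_deriv (poly (Q n)) z - log_deriv (poly (Q (Suc n))) z"
    using nz[of n] nz[of "Suc n"] unfolding w_def
    by eventually_elim (intro log_deriv_divide field_differentiable_poly)
  then have "expands_at_infinity w F"
    unfolding F_def
    by (rule expands_at_infinity_cong)
       (intro expands_at_infinity_diff expands_at_infinity_log_deriv_poly lead)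
  moreover have "\<forall>\<^sub>F z in at_infinity. z \<in> {z. poly (Q n) z \<noteq> 0 \<and> poly (Q (Suc n)) z \<noteq> 0}"
    using nz[of n] nz[of "Suc n"] by eventually_elim simp
  ultimately have "Phi (of_nat (Suc n)) F = F"
    using sol by (intro fourth_order_solution_expansion)
  moreover obtain G where G: "expansion_at_infinity (of_nat (Suc n)) = fps_to_fls G"
    using formal_solution_imp_fps[OF formal_solution_expansion] .
  then have "Phi (of_nat (Suc n)) G = G"
    using formal_solution_expansion[of "of_nat (Suc n)"] unfolding G formal_solution_fps by blast
  ultimately have "expansion_at_infinity (of_nat (Suc n)) = fps_to_fls F"
    using Phi_fixed_point_unique G by blast
  then show ?thesis
    by (simp add: expansion_coeff_def F_def nat_add_distrib)
qed

lemma expansion_coeff_eq_0: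
  assumes "\<And>l::nat. j \<noteq> - (5 * int l + 1)"
  shows "expansion_coeff \<alpha> j = 0"
proof (rule ccontr)
  assume "expansion_coeff \<alpha> j \<noteq> 0"
  then obtain l :: nat where "- j = 5 * int l + 1"
    using formal_solution_expansion[of \<alpha>]
    unfolding formal_solution_def expansion_coeff_def by blast
  with assms[of l] show False by linarith
qed

lemma root_power_sum_special_polynomial_1:
  assumes Q: "special_polynomials Q" and "m \<ge> 1"
  shows "root_power_sum (Q 1) m = 0"
proof -
  have "size (proots (Q 1)) = 1"
    using Q by (simp add: size_proots_complex special_polynomials_def)
  then obtain a where a: "proots (Q 1) = {#a#}"
    using size_1_singleton_mset by blast
  \<comment> \<open>The exponent -2 is not of the form -5l - 1. As \<open>Q 0 = 1\<close> has no
    roots, the coefficient formula at n = 0, m = 1 identifies this coefficient with -a.\<close>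
  have "expansion_coeff 1 (- (int 1 + 1)) = 0"
    by (rule expansion_coeff_eq_0) presburger
  with special_polynomials_expansion_coeff[OF Q, of 0 1] have "a = 0"
    using Q a by (simp add: root_power_sum_def special_polynomials_def)
  \<comment> \<open>Here m \<ge> 1 matters, because 0^0 = 1.\<close>
  with a \<open>m \<ge> 1\<close> show ?thesis by (simp add: root_power_sum_def)
qed

theorem theorem5p1:
  fixes Q :: "nat \<Rightarrow> complex poly" and n m :: nat
  assumes "special_polynomials Q" and "n \<ge> 2" and "m \<ge> 1"
  shows "root_power_sum (Q n) m = - (\<Sum>i=2..n. expansion_coeff (of_nat i) (- (int m + 1)))"
proof -
  \<comment> \<open>The telescoping sum is proved with its boundary term at index 1 kept; that term
    vanishes by the preceding lemma.\<close>
  have "root_power_sum (Q n) m - root_power_sum (Q 1) m =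
      - (\<Sum>i=2..n. expansion_coeff (of_nat i) (- (int m + 1)))"
    using \<open>n \<ge> 2\<close>
  proof (induction n rule: nat_induct_at_least)
    case base
    show ?case
      using special_polynomials_expansion_coeff[OF assms(1), of 1 m] by (simp add: numeral_2_eq_2)
  next
    case (Suc n)
    have "root_power_sum (Q (Suc n)) m - root_power_sum (Q 1) m =
        (root_power_sum (Q n) m - root_power_sum (Q 1) m) -
        (root_power_sum (Q n) m - root_power_sum (Q (Suc n)) m)"
      by simp
    also have "\<dots> = - (\<Sum>i=2..n. expansion_coeff (of_nat i) (- (int m + 1)))
        - expansion_coeff (of_nat (Suc n)) (- (int m + 1))"
      by (simp only: Suc.IH special_polynomials_expansion_coeff[OF assms(1)])
    finally show ?case
      using \<open>2 \<le> n\<close> by (simp del: of_nat_Suc)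
  qed
  then show ?thesis
    using root_power_sum_special_polynomial_1[OF assms(1,3)] by simp
qed

end
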